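(* Let $M$ and $N$ be compact oriented smooth manifolds without boundary, of dimension $4k$. If there is an orientation preserving diffeomorphism $\phi:M\to N$, then $\sigma(M)=\sigma(N)$.
   Context: For a compact oriented smooth manifold $M$ without boundary of dimension $4k$, the signature $\sigma(M)$ is the signature (number of positive eigenvalues minus number of negative eigenvalues of a representing symmetric matrix) of the symmetric bilinear form $Q([\omega_1],[\omega_2])=\int_M\omega_1\wedge\omega_2$ on the real de Rham cohomology $H^{2k}(M)$. *)

theory Defs
  imports "HOL-Analysis.Analysis" "Jordan_Normal_Form.Char_Poly"
begin

text \<open>
  Neither smooth manifolds nor de Rham cohomology are available in the libraries.
  Real n-space is the library's \<open>Euclidean_space n\<close>: the functions \<open>nat \<Rightarrow> real\<close>
  vanishing at all indices \<open>\<ge> n\<close>. The dimension is thus a term, and \<open>n = 0\<close> is included.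
\<close>

section \<open>Calculus on open subsets of real n-space\<close>

definition pderivative :: "nat \<Rightarrow> ((nat \<Rightarrow> real) \<Rightarrow> real) \<Rightarrow> (nat \<Rightarrow> real) \<Rightarrow> real" where
  "pderivative i f x = deriv (\<lambda>t. f (x(i := t))) (x i)"

text \<open>Class \<open>C\<^sup>\<infinity>\<close>: all iterated partial derivatives exist and are continuous.\<close>

definition smooth_fun_on :: "nat \<Rightarrow> (nat \<Rightarrow> real) set \<Rightarrow> ((nat \<Rightarrow> real) \<Rightarrow> real) \<Rightarrow> bool" where
  "smooth_fun_on n U f \<longleftrightarrow>
     (\<forall>js. set js \<subseteq> {..<n} \<longrightarrow>
        (let g = foldr pderivative js f in
           continuous_map (subtopology (Euclidean_space n) U) euclideanreal g \<and>
           (\<forall>x\<in>U. \<forall>i<n. (\<lambda>t. g (x(i := t))) differentiable at (x i))))"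

definition smooth_into_on ::
    "nat \<Rightarrow> nat \<Rightarrow> (nat \<Rightarrow> real) set \<Rightarrow> ((nat \<Rightarrow> real) \<Rightarrow> (nat \<Rightarrow> real)) \<Rightarrow> bool" where
  "smooth_into_on n m U f \<longleftrightarrow> (\<forall>i<m. smooth_fun_on n U (\<lambda>x. f x i))"

definition jacobian :: "nat \<Rightarrow> ((nat \<Rightarrow> real) \<Rightarrow> (nat \<Rightarrow> real)) \<Rightarrow> (nat \<Rightarrow> real) \<Rightarrow> real mat" where
  "jacobian n f x = Matrix.mat n n (\<lambda>(i, j). pderivative j (\<lambda>y. f y i) x)"

definition differential ::
    "nat \<Rightarrow> ((nat \<Rightarrow> real) \<Rightarrow> (nat \<Rightarrow> real)) \<Rightarrow> (nat \<Rightarrow> real) \<Rightarrow> (nat \<Rightarrow> real) \<Rightarrow> (nat \<Rightarrow> real)" where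
  "differential n f x v =
     (\<lambda>i. if i < n then \<Sum>j<n. pderivative j (\<lambda>y. f y i) x * v j else 0)"

definition std_basis_vec :: "nat \<Rightarrow> nat \<Rightarrow> real" where
  "std_basis_vec i = (\<lambda>l. if l = i then 1 else 0)"

section \<open>Oriented smooth manifolds and smooth maps\<close>

text \<open>
  A chart is its domain together with its coordinate map. Coordinate maps are
  \<open>undefined\<close> off the domain, so that equal charts are equal terms.
\<close>

type_synonym 'a chart = "'a set \<times> ('a \<Rightarrow> nat \<Rightarrow> real)"

definition chart_inv :: "'a chart \<Rightarrow> (nat \<Rightarrow> real) \<Rightarrow> 'a" where
  "chart_inv c = inv_into (fst c) (snd c)"

definition chart_image :: "'a chart \<Rightarrow> (nat \<Rightarrow> real) set" where
  "chart_image c = snd c ` fst c"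

definition is_chart :: "nat \<Rightarrow> 'a topology \<Rightarrow> 'a chart \<Rightarrow> bool" where
  "is_chart n X c \<longleftrightarrow>
     openin X (fst c) \<and> snd c \<in> extensional (fst c) \<and>
     openin (Euclidean_space n) (chart_image c) \<and>
     homeomorphic_map (subtopology X (fst c))
       (subtopology (Euclidean_space n) (chart_image c)) (snd c)"

text \<open>
  The representation \<open>c' \<circ> f \<circ> c\<^sup>-\<^sup>1\<close> of a map in charts and the set on which it is
  defined; for \<open>f = id\<close> this is the transition map from \<open>c\<close> to \<open>c'\<close>.
\<close>

definition coord_rep ::
    "'a chart \<Rightarrow> ('a \<Rightarrow> 'b) \<Rightarrow> 'b chart \<Rightarrow> (nat \<Rightarrow> real) \<Rightarrow> (nat \<Rightarrow> real)" where
  "coord_rep c f c' = (\<lambda>x. snd c' (f (chart_inv c x)))"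

definition coord_dom :: "'a chart \<Rightarrow> ('a \<Rightarrow> 'b) \<Rightarrow> 'b chart \<Rightarrow> (nat \<Rightarrow> real) set" where
  "coord_dom c f c' = snd c ` {p \<in> fst c. f p \<in> fst c'}"

definition charts_compatible :: "nat \<Rightarrow> 'a chart \<Rightarrow> 'a chart \<Rightarrow> bool" where
  "charts_compatible n c c' \<longleftrightarrow>
     smooth_into_on n n (coord_dom c id c') (coord_rep c id c') \<and>
     smooth_into_on n n (coord_dom c' id c) (coord_rep c' id c)"

definition smooth_structure :: "nat \<Rightarrow> 'a topology \<Rightarrow> 'a chart set \<Rightarrow> bool" where
  "smooth_structure n X \<A> \<longleftrightarrow>
     (\<forall>c\<in>\<A>. is_chart n X c) \<and>
     (\<Union>c\<in>\<A>. fst c) = topspace X \<and>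
     (\<forall>c\<in>\<A>. \<forall>c'\<in>\<A>. charts_compatible n c c') \<and>
     (\<forall>c. is_chart n X c \<and> (\<forall>c'\<in>\<A>. charts_compatible n c c') \<longrightarrow> c \<in> \<A>)"

text \<open>
  An orientation is a continuous choice of orientation of all tangent spaces. It is encoded
  by signs: \<open>osign c p\<close> is \<open>1\<close> if the coordinate frame of the chart \<open>c\<close> at \<open>p\<close> is positively
  oriented, and \<open>-1\<close> otherwise. In dimension 0, where oriented atlases would carry no
  information, this is the usual choice of a sign for each point.
\<close>

definition orientation_signs ::
    "nat \<Rightarrow> 'a topology \<Rightarrow> 'a chart set \<Rightarrow> ('a chart \<Rightarrow> 'a \<Rightarrow> real) \<Rightarrow> bool" where
  "orientation_signs n X \<A> s \<longleftrightarrow>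
     (\<forall>c\<in>\<A>. \<forall>p\<in>fst c. s c p \<in> {1, -1}) \<and>
     (\<forall>c\<in>\<A>. continuous_map (subtopology X (fst c)) euclideanreal (s c)) \<and>
     (\<forall>c\<in>\<A>. \<forall>c'\<in>\<A>. \<forall>p\<in>fst c \<inter> fst c'.
        s c p = s c' p * sgn (Determinant.det (jacobian n (coord_rep c id c') (snd c p))))"

record 'a oriented_manifold =
  mdim :: nat
  mtop :: "'a topology"
  atlas :: "'a chart set"
  osign :: "'a chart \<Rightarrow> 'a \<Rightarrow> real"

text \<open>Charts have open image in \<open>Euclidean_space n\<close>, so there is no boundary.\<close>

definition oriented_smooth_manifold :: "'a oriented_manifold \<Rightarrow> bool" where
  "oriented_smooth_manifold M \<longleftrightarrow>
     Hausdorff_space (mtop M) \<and> second_countable (mtop M) \<and>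
     smooth_structure (mdim M) (mtop M) (atlas M) \<and>
     orientation_signs (mdim M) (mtop M) (atlas M) (osign M)"

definition compact_oriented_smooth_manifold :: "'a oriented_manifold \<Rightarrow> bool" where
  "compact_oriented_smooth_manifold M \<longleftrightarrow>
     oriented_smooth_manifold M \<and> compact_space (mtop M)"

definition smooth_map :: "'a oriented_manifold \<Rightarrow> 'b oriented_manifold \<Rightarrow> ('a \<Rightarrow> 'b) \<Rightarrow> bool" where
  "smooth_map M N f \<longleftrightarrow>
     continuous_map (mtop M) (mtop N) f \<and>
     (\<forall>c\<in>atlas M. \<forall>c'\<in>atlas N.
        smooth_into_on (mdim M) (mdim N) (coord_dom c f c') (coord_rep c f c'))"

definition diffeomorphism ::
    "'a oriented_manifold \<Rightarrow> 'b oriented_manifold \<Rightarrow> ('a \<Rightarrow> 'b) \<Rightarrow> bool" where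
  "diffeomorphism M N \<phi> \<longleftrightarrow>
     smooth_map M N \<phi> \<and>
     (\<exists>\<psi>. smooth_map N M \<psi> \<and>
        (\<forall>p\<in>topspace (mtop M). \<psi> (\<phi> p) = p) \<and> (\<forall>q\<in>topspace (mtop N). \<phi> (\<psi> q) = q))"

text \<open>
  The differential at \<open>p\<close> sends positively oriented frames to positively oriented ones: the
  image of the coordinate frame of \<open>c\<close> differs from that of \<open>c'\<close> by the Jacobian matrix.
\<close>

definition orientation_preserving ::
    "'a oriented_manifold \<Rightarrow> 'b oriented_manifold \<Rightarrow> ('a \<Rightarrow> 'b) \<Rightarrow> bool" where
  "orientation_preserving M N \<phi> \<longleftrightarrow>
     (\<forall>c\<in>atlas M. \<forall>c'\<in>atlas N. \<forall>p\<in>fst c. \<phi> p \<in> fst c' \<longrightarrow>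
        osign M c p =
          osign N c' (\<phi> p) * sgn (Determinant.det (jacobian (mdim M) (coord_rep c \<phi> c') (snd c p))))"

section \<open>Differential forms\<close>

text \<open>
  A \<open>p\<close>-form is given by its representations in all charts: \<open>\<omega> c x vs\<close> is the value at the point
  with coordinates \<open>x\<close> in \<open>c\<close> on \<open>p\<close> tangent vectors, expressed in the coordinate frame of \<open>c\<close>.
  The value is 0 on meaningless arguments, which makes equality of forms extensional.
\<close>

type_synonym 'a form = "'a chart \<Rightarrow> (nat \<Rightarrow> real) \<Rightarrow> (nat \<Rightarrow> real) list \<Rightarrow> real"

definition alternating_multilinear :: "nat \<Rightarrow> nat \<Rightarrow> ((nat \<Rightarrow> real) list \<Rightarrow> real) \<Rightarrow> bool" where
  "alternating_multilinear n p \<alpha> \<longleftrightarrow>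
     (\<forall>vs. set vs \<subseteq> topspace (Euclidean_space n) \<and> length vs = p \<longrightarrow>
        (\<forall>i<p. \<forall>u\<in>topspace (Euclidean_space n). \<forall>w\<in>topspace (Euclidean_space n). \<forall>a b.
           \<alpha> (vs[i := (\<lambda>l. a * u l + b * w l)]) = a * \<alpha> (vs[i := u]) + b * \<alpha> (vs[i := w])) \<and>
        (\<forall>i<p. \<forall>j<p. i \<noteq> j \<and> vs ! i = vs ! j \<longrightarrow> \<alpha> vs = 0))"

definition forms :: "'a oriented_manifold \<Rightarrow> nat \<Rightarrow> 'a form set" where
  "forms M p = {\<omega>.
     (\<forall>c x vs. \<not> (c \<in> atlas M \<and> x \<in> chart_image c \<and>
                   set vs \<subseteq> topspace (Euclidean_space (mdim M)) \<and> length vs = p) \<longrightarrow>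
        \<omega> c x vs = 0) \<and>
     (\<forall>c\<in>atlas M. \<forall>x\<in>chart_image c. alternating_multilinear (mdim M) p (\<omega> c x)) \<and>
     (\<forall>c\<in>atlas M. \<forall>vs. set vs \<subseteq> topspace (Euclidean_space (mdim M)) \<and> length vs = p \<longrightarrow>
        smooth_fun_on (mdim M) (chart_image c) (\<lambda>x. \<omega> c x vs)) \<and>
     (\<forall>c\<in>atlas M. \<forall>c'\<in>atlas M. \<forall>x\<in>coord_dom c id c'.
        \<forall>vs. set vs \<subseteq> topspace (Euclidean_space (mdim M)) \<and> length vs = p \<longrightarrow>
        \<omega> c x vs =
          \<omega> c' (coord_rep c id c' x) (map (differential (mdim M) (coord_rep c id c') x) vs))}"

text \<open>
  In coordinates and for constant vectors, \<open>d\<omega>(v\<^sub>0, \<dots>, v\<^sub>p)\<close> is the sum over \<open>i\<close> of \<open>(-1)\<^sup>i\<close> times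
  the derivative in direction \<open>v\<^sub>i\<close> of the function \<open>\<omega>(v\<^sub>0, \<dots>, v\<^sub>p)\<close> with \<open>v\<^sub>i\<close> omitted.
\<close>

definition ext_deriv :: "'a oriented_manifold \<Rightarrow> 'a form \<Rightarrow> 'a form" where
  "ext_deriv M \<omega> = (\<lambda>c x vs.
     if c \<in> atlas M \<and> x \<in> chart_image c \<and> set vs \<subseteq> topspace (Euclidean_space (mdim M)) then
       \<Sum>i<length vs. (- 1) ^ i *
         (\<Sum>j<mdim M. (vs ! i) j *
            pderivative j (\<lambda>y. \<omega> c y (take i vs @ drop (Suc i) vs)) x)
     else 0)"

text \<open>Wedge product of a \<open>p\<close>-form and a \<open>q\<close>-form.\<close>

definition wedge :: "nat \<Rightarrow> nat \<Rightarrow> 'a form \<Rightarrow> 'a form \<Rightarrow> 'a form" where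
  "wedge p q \<alpha> \<beta> = (\<lambda>c x vs.
     if length vs = p + q then
       1 / (fact p * fact q) *
         (\<Sum>\<pi> | \<pi> permutes {..<p + q}.
            of_int (sign \<pi>) * \<alpha> c x (take p (permute_list \<pi> vs)) * \<beta> c x (drop p (permute_list \<pi> vs)))
     else 0)"

section \<open>Integration\<close>

definition smooth_partition_of_unity ::
    "'a oriented_manifold \<Rightarrow> nat \<Rightarrow> (nat \<Rightarrow> 'a chart) \<Rightarrow> (nat \<Rightarrow> 'a \<Rightarrow> real) \<Rightarrow> bool" where
  "smooth_partition_of_unity M m c \<rho> \<longleftrightarrow>
     (\<forall>i<m. c i \<in> atlas M \<and>
        (\<forall>p\<in>topspace (mtop M). 0 \<le> \<rho> i p) \<and>
        (\<forall>c'\<in>atlas M. smooth_fun_on (mdim M) (chart_image c') (\<lambda>x. \<rho> i (chart_inv c' x))) \<and>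
        mtop M closure_of {p \<in> topspace (mtop M). \<rho> i p \<noteq> 0} \<subseteq> fst (c i)) \<and>
     (\<forall>p\<in>topspace (mtop M). (\<Sum>i<m. \<rho> i p) = 1)"

text \<open>
  The integral of \<open>\<rho>\<omega>\<close> over the domain of \<open>c\<close>, for a top-degree form \<open>\<omega>\<close>. The library's Lebesgue
  measure on real n-space lives on functions that are \<open>undefined\<close> at indices \<open>\<ge> n\<close>, whence
  the conversion to \<open>y\<close>.
\<close>

definition chart_integral :: "'a oriented_manifold \<Rightarrow> 'a chart \<Rightarrow> ('a \<Rightarrow> real) \<Rightarrow> 'a form \<Rightarrow> real" where
  "chart_integral M c \<rho> \<omega> =
     (LINT x | Pi\<^sub>M {..<mdim M} (\<lambda>_. lborel :: real measure).
        (let y = (\<lambda>i. if i < mdim M then x i else 0) in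
          if y \<in> chart_image c then
            osign M c (chart_inv c y) * \<rho> (chart_inv c y) *
              \<omega> c y (map std_basis_vec [0..<mdim M])
          else 0))"

text \<open>On compact manifolds the sum below exists and does not depend on the partition of unity.\<close>

definition manifold_integral :: "'a oriented_manifold \<Rightarrow> 'a form \<Rightarrow> real" where
  "manifold_integral M \<omega> =
     (THE r. \<exists>m c \<rho>. smooth_partition_of_unity M m c \<rho> \<and>
                    r = (\<Sum>i<m. chart_integral M (c i) (\<rho> i) \<omega>))"

section \<open>De Rham cohomology and the signature\<close>

definition closed_forms :: "'a oriented_manifold \<Rightarrow> nat \<Rightarrow> 'a form set" where
  "closed_forms M p = {\<omega> \<in> forms M p. ext_deriv M \<omega> = (\<lambda>c x vs. 0)}"

definition exact_forms :: "'a oriented_manifold \<Rightarrow> nat \<Rightarrow> 'a form set" where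
  "exact_forms M p =
     (if p = 0 then {\<lambda>c x vs. 0} else ext_deriv M ` forms M (p - 1))"

definition dR_class :: "'a oriented_manifold \<Rightarrow> nat \<Rightarrow> 'a form \<Rightarrow> 'a form set" where
  "dR_class M p \<omega> = {\<lambda>c x vs. \<omega> c x vs + \<eta> c x vs | \<eta>. \<eta> \<in> exact_forms M p}"

definition dR_cohomology :: "'a oriented_manifold \<Rightarrow> nat \<Rightarrow> 'a form set set" where
  "dR_cohomology M p = dR_class M p ` closed_forms M p"

text \<open>The linear combination \<open>\<Sum>i. a i \<cdot> Bs ! i\<close> in the quotient space, as a coset.\<close>

definition dR_lincomb ::
    "'a oriented_manifold \<Rightarrow> nat \<Rightarrow> (nat \<Rightarrow> real) \<Rightarrow> 'a form set list \<Rightarrow> 'a form set" where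
  "dR_lincomb M p a Bs =
     {\<lambda>c x vs. (\<Sum>i<length Bs. a i * \<omega> i c x vs) + \<eta> c x vs | \<omega> \<eta>.
        (\<forall>i<length Bs. \<omega> i \<in> Bs ! i) \<and> \<eta> \<in> exact_forms M p}"

text \<open>The zero class is the coset \<open>exact_forms M p\<close>.\<close>

definition dR_basis :: "'a oriented_manifold \<Rightarrow> nat \<Rightarrow> 'a form set list \<Rightarrow> bool" where
  "dR_basis M p Bs \<longleftrightarrow>
     set Bs \<subseteq> dR_cohomology M p \<and>
     (\<forall>C\<in>dR_cohomology M p. \<exists>a. C = dR_lincomb M p a Bs) \<and>
     (\<forall>a. dR_lincomb M p a Bs = exact_forms M p \<longrightarrow> (\<forall>i<length Bs. a i = 0))"

text \<open>
  \<open>Q([\<omega>\<^sub>1], [\<omega>\<^sub>2]) = \<integral>\<^sub>M \<omega>\<^sub>1 \<and> \<omega>\<^sub>2\<close> on \<open>H\<^sup>p(M)\<close>; by Stokes' theorem the value does not depend on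
  the representatives.
\<close>

definition intersection_form ::
    "'a oriented_manifold \<Rightarrow> nat \<Rightarrow> 'a form set \<Rightarrow> 'a form set \<Rightarrow> real" where
  "intersection_form M p A B =
     (THE r. \<exists>\<omega>\<^sub>1\<in>A. \<exists>\<omega>\<^sub>2\<in>B. r = manifold_integral M (wedge p p \<omega>\<^sub>1 \<omega>\<^sub>2))"

definition intersection_matrix :: "'a oriented_manifold \<Rightarrow> nat \<Rightarrow> 'a form set list \<Rightarrow> real mat" where
  "intersection_matrix M p Bs =
     Matrix.mat (length Bs) (length Bs) (\<lambda>(i, j). intersection_form M p (Bs ! i) (Bs ! j))"

text \<open>Eigenvalues (the roots of the characteristic polynomial) are counted with multiplicity.\<close>

definition matrix_signature :: "real mat \<Rightarrow> int" where
  "matrix_signature A =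
     int (size (filter_mset (\<lambda>x. x > 0) (proots (char_poly A)))) -
     int (size (filter_mset (\<lambda>x. x < 0) (proots (char_poly A))))"

text \<open>
  The middle degree is \<open>2k\<close> in dimension \<open>4k\<close>. By Sylvester's law of inertia the value is the
  same for every basis.
\<close>

definition manifold_signature :: "'a oriented_manifold \<Rightarrow> int" where
  "manifold_signature M =
     (THE s. \<exists>Bs. dR_basis M (mdim M div 2) Bs \<and>
                  s = matrix_signature (intersection_matrix M (mdim M div 2) Bs))"

end

theory Submission
  imports Defs
begin

text \<open>
  The signature is built from the manifold by constructions that never look inside its points,
  so it is carried along by an isomorphism of the underlying structure; neither Stokes' theorem
  nor Sylvester's law of inertia enters.

  The isomorphism is a bijection of atlases. If \<open>x\<close> is a chart of \<open>M\<close> on \<open>U\<close>, then \<open>x \<circ> \<phi>\<^sup>-\<^sup>1\<close> on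
  \<open>\<phi>(U)\<close> is compatible with every chart of \<open>N\<close>, since the transition maps are just the coordinate
  representations of \<open>\<phi>\<close> and \<open>\<phi>\<^sup>-\<^sup>1\<close>, and hence belongs to the maximal atlas of \<open>N\<close>
  (\<open>push_in_atlas\<close>). A chart and its transport have the same image, and two charts have the
  same transition map as their transports. A form is a family of coordinate
  representations indexed by the atlas, so reindexing it along this bijection is the pullback
  \<open>\<phi>\<^sup>*\<close>, without any Jacobian factor: in transported charts, \<open>\<phi>\<close> is the identity.
  For the same reason \<open>\<phi>\<^sup>*\<close> commutes with the exterior derivative and the wedge product, and so maps
  bases of de Rham cohomology to bases (\<open>dR_basis_pull\<close>).

  Orientation enters only through the integral. Because \<open>\<phi>\<close> is the identity in transported charts,
  preserving orientation says exactly that the orientation sign of a chart equals that of its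
  transport. Pulling partitions of unity back along \<open>\<phi>\<close> then matches the integrals
  chart by chart (\<open>manifold_integral_pull\<close>), so that corresponding bases
  have the same intersection matrix.

  The integral, the intersection form and the signature are definite descriptions. It is shown
  that the described predicates are the same for both manifolds, which gives equal
  values whether or not the descriptions are known to be unique. Charts, forms,
  bases and partitions of unity then have to be carried in both directions; the locales below fix
  \<open>\<phi>\<close> together with its inverse \<open>\<psi>\<close> so that their symmetry turns one direction into the other.
\<close>

section \<open>Smoothness is local\<close>

lemma eventually_fun_upd_in_open:
  assumes U: "openin (Euclidean_space n) U" and x: "x \<in> U" and i: "i < n"
  shows "\<forall>\<^sub>F t in nhds (x i). x(i := t) \<in> U"
proof -
  have x0: "x \<in> topspace (Euclidean_space n)"
    using U x openin_subset by blast
  have "continuous_map euclideanreal (powertop_real UNIV) (\<lambda>t. x(i := t))"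
    unfolding continuous_map_componentwise_UNIV by simp
  then have "continuous_map euclideanreal (Euclidean_space n) (\<lambda>t. x(i := t))"
    using x0 i unfolding Euclidean_space_def continuous_map_in_subtopology by auto
  then have "openin euclideanreal {t \<in> topspace euclideanreal. x(i := t) \<in> U}"
    using U by (rule openin_continuous_map_preimage)
  then have "open {t. x(i := t) \<in> U}"
    by simp
  then show ?thesis
    using x unfolding eventually_nhds by (intro exI[of _ "{t. x(i := t) \<in> U}"]) auto
qed

text \<open>
  Transported objects agree with the original ones only on the image of a chart: elsewhere the
  inverse of a chart takes arbitrary values. The congruence rules on open sets make this harmless.
\<close>

lemma pderivative_cong_open:
  assumes "openin (Euclidean_space n) U" "x \<in> U" "i < n" "\<And>y. y \<in> U \<Longrightarrow> f y = g y"
  shows "pderivative i f x = pderivative i g x"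
  unfolding pderivative_def
  using eventually_fun_upd_in_open[OF assms(1-3)] assms(4)
  by (intro deriv_cong_ev) (auto elim: eventually_mono)

lemma foldr_pderivative_cong_open:
  assumes U: "openin (Euclidean_space n) U" and fg: "\<And>y. y \<in> U \<Longrightarrow> f y = g y"
    and "set js \<subseteq> {..<n}" and "x \<in> U"
  shows "foldr pderivative js f x = foldr pderivative js g x"
  using assms(3,4)
proof (induction js arbitrary: x)
  case (Cons j js)
  then show ?case
    by (auto intro!: pderivative_cong_open[OF U])
qed (simp add: fg)

lemma smooth_fun_on_cong_open_imp:
  assumes U: "openin (Euclidean_space n) U" and fg: "\<And>y. y \<in> U \<Longrightarrow> f y = g y"
    and f: "smooth_fun_on n U f"
  shows "smooth_fun_on n U g"
  unfolding smooth_fun_on_def Let_def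
proof (intro allI impI conjI ballI)
  fix js :: "nat list"
  assume js: "set js \<subseteq> {..<n}"
  have eq: "foldr pderivative js f y = foldr pderivative js g y" if "y \<in> U" for y
    using foldr_pderivative_cong_open[OF U _ js that] fg by blast
  have F: "continuous_map (subtopology (Euclidean_space n) U) euclideanreal (foldr pderivative js f)"
    and D: "\<And>x i. x \<in> U \<Longrightarrow> i < n \<Longrightarrow>
      (\<lambda>t. foldr pderivative js f (x(i := t))) differentiable at (x i)"
    using f js unfolding smooth_fun_on_def Let_def by blast+
  show "continuous_map (subtopology (Euclidean_space n) U) euclideanreal (foldr pderivative js g)"
    using F by (rule continuous_map_eq) (auto intro: eq)
  fix x i
  assume x: "x \<in> U" and i: "i < n"
  obtain D' where "((\<lambda>t. foldr pderivative js f (x(i := t))) has_derivative D') (at (x i))"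
    using D[OF x i] unfolding differentiable_def by blast
  moreover have "\<forall>\<^sub>F t in at (x i). foldr pderivative js f (x(i := t)) = foldr pderivative js g (x(i := t))"
    using eventually_fun_upd_in_open[OF U x i]
    unfolding eventually_at_filter by (rule eventually_mono) (simp add: eq)
  moreover have "foldr pderivative js f (x(i := x i)) = foldr pderivative js g (x(i := x i))"
    using eq[OF x] by simp
  ultimately have "((\<lambda>t. foldr pderivative js g (x(i := t))) has_derivative D') (at (x i))"
    by (rule has_derivative_transform_eventually) simp
  then show "(\<lambda>t. foldr pderivative js g (x(i := t))) differentiable at (x i)"
    unfolding differentiable_def by blast
qed

lemma smooth_fun_on_cong_open:
  assumes "openin (Euclidean_space n) U" and "\<And>y. y \<in> U \<Longrightarrow> f y = g y"
  shows "smooth_fun_on n U f \<longleftrightarrow> smooth_fun_on n U g"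
  using smooth_fun_on_cong_open_imp[OF assms(1), of f g]
    smooth_fun_on_cong_open_imp[OF assms(1), of g f] assms(2) by auto

lemma smooth_into_on_cong_open:
  assumes "openin (Euclidean_space n) U" and "\<And>y. y \<in> U \<Longrightarrow> f y = g y"
  shows "smooth_into_on n m U f \<longleftrightarrow> smooth_into_on n m U g"
  unfolding smooth_into_on_def
  using smooth_fun_on_cong_open[OF assms(1), of "\<lambda>x. f x i" "\<lambda>x. g x i" for i] assms(2) by simp

lemma differential_cong_open:
  assumes "openin (Euclidean_space n) U" "x \<in> U" "\<And>y. y \<in> U \<Longrightarrow> f y = g y"
  shows "differential n f x = differential n g x"
proof
  fix v
  have "pderivative j (\<lambda>y. f y i) x = pderivative j (\<lambda>y. g y i) x" if "j < n" for i j
    using assms that by (intro pderivative_cong_open[where n = n and U = U]) auto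
  then show "differential n f x v = differential n g x v"
    unfolding differential_def by (intro ext) simp
qed

lemma jacobian_eq_one:
  assumes U: "openin (Euclidean_space n) U" and x: "x \<in> U" and f: "\<And>y. y \<in> U \<Longrightarrow> f y = y"
  shows "jacobian n f x = 1\<^sub>m n"
proof (rule eq_matI)
  fix i j
  assume ij: "i < dim_row (1\<^sub>m n :: real mat)" "j < dim_col (1\<^sub>m n :: real mat)"
  have "pderivative j (\<lambda>y. f y i) x = pderivative j (\<lambda>y. y i) x"
    using ij f by (intro pderivative_cong_open[OF U x]) auto
  also have "\<dots> = (if i = j then 1 else 0)"
    unfolding pderivative_def by auto
  finally show "jacobian n f x $$ (i, j) = 1\<^sub>m n $$ (i, j)"
    using ij by (simp add: jacobian_def)
qed (simp_all add: jacobian_def)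

section \<open>Transport of charts\<close>

lemma chart_inv_in:
  "x \<in> chart_image c \<Longrightarrow> chart_inv c x \<in> fst c"
  unfolding chart_inv_def chart_image_def by (rule inv_into_into)

lemma is_chart_inj_on:
  assumes "is_chart n X c"
  shows "inj_on (snd c) (fst c)"
proof -
  have "fst c \<subseteq> topspace X"
    using assms openin_subset unfolding is_chart_def by blast
  then show ?thesis
    using assms homeomorphic_imp_injective_map unfolding is_chart_def
    by (metis topspace_subtopology_subset)
qed

text \<open>Openness of this set is what allows derivatives of coordinate representations to be compared.\<close>

lemma openin_coord_dom:
  assumes c: "is_chart n X c" and f: "continuous_map X Y f" and c': "openin Y (fst c')"
  shows "openin (Euclidean_space n) (coord_dom c f c')"
proof -
  have oc: "openin X (fst c)"
    using c unfolding is_chart_def by blast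
  have "{p \<in> fst c. f p \<in> fst c'} = fst c \<inter> {p \<in> topspace X. f p \<in> fst c'}"
    using openin_subset[OF oc] by auto
  moreover have "openin X {p \<in> topspace X. f p \<in> fst c'}"
    using f c' by (rule openin_continuous_map_preimage)
  ultimately have "openin (subtopology X (fst c)) {p \<in> fst c. f p \<in> fst c'}"
    by (auto simp: openin_subtopology)
  then have "openin (subtopology (Euclidean_space n) (chart_image c)) (coord_dom c f c')"
    using c homeomorphic_map_openness_eq unfolding is_chart_def coord_dom_def by blast
  then show ?thesis
    using c unfolding is_chart_def by (meson openin_trans_full)
qed

text \<open>
  The restriction makes the transported chart extensional, so that it can be a member of an atlas
  and transporting it back returns the original term.
\<close>

definition push_chart :: "('a \<Rightarrow> 'b) \<Rightarrow> ('b \<Rightarrow> 'a) \<Rightarrow> 'a chart \<Rightarrow> 'b chart" where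
  "push_chart \<phi> \<psi> c = (\<phi> ` fst c, restrict (snd c \<circ> \<psi>) (\<phi> ` fst c))"

locale inverse_diffeomorphisms =
  fixes M :: "'a oriented_manifold" and N :: "'b oriented_manifold"
    and \<phi> :: "'a \<Rightarrow> 'b" and \<psi> :: "'b \<Rightarrow> 'a"
  assumes M: "oriented_smooth_manifold M" and N: "oriented_smooth_manifold N"
    and dim: "mdim M = mdim N"
    and smooth: "smooth_map M N \<phi>" and smooth_inv: "smooth_map N M \<psi>"
    and inv: "\<And>p. p \<in> topspace (mtop M) \<Longrightarrow> \<psi> (\<phi> p) = p"
    and inv': "\<And>q. q \<in> topspace (mtop N) \<Longrightarrow> \<phi> (\<psi> q) = q"
begin

lemma inverse: "inverse_diffeomorphisms N M \<psi> \<phi>"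
  using M N dim smooth smooth_inv inv inv' by unfold_locales auto

abbreviation push :: "'a chart \<Rightarrow> 'b chart" where
  "push \<equiv> push_chart \<phi> \<psi>"

lemma atlas_is_chart: "c \<in> atlas M \<Longrightarrow> is_chart (mdim M) (mtop M) c"
  using M unfolding oriented_smooth_manifold_def smooth_structure_def by blast

lemma chart_domain_subset: "c \<in> atlas M \<Longrightarrow> fst c \<subseteq> topspace (mtop M)"
  using atlas_is_chart openin_subset unfolding is_chart_def by blast

lemma openin_chart_image: "c \<in> atlas M \<Longrightarrow> openin (Euclidean_space (mdim M)) (chart_image c)"
  using atlas_is_chart unfolding is_chart_def by blast

lemma homeomorphic_maps: "homeomorphic_maps (mtop M) (mtop N) \<phi> \<psi>"
  using smooth smooth_inv inv inv' unfolding homeomorphic_maps_def smooth_map_def by blast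

lemma homeo: "homeomorphic_map (mtop M) (mtop N) \<phi>"
  using homeomorphic_maps homeomorphic_maps_map by blast

lemma homeo_inv: "homeomorphic_map (mtop N) (mtop M) \<psi>"
  using homeomorphic_maps homeomorphic_maps_map by blast

lemma phi_in: "p \<in> topspace (mtop M) \<Longrightarrow> \<phi> p \<in> topspace (mtop N)"
  using homeo homeomorphic_imp_surjective_map by blast

lemma inv_chart: "c \<in> atlas M \<Longrightarrow> p \<in> fst c \<Longrightarrow> \<psi> (\<phi> p) = p"
  using chart_domain_subset inv by blast

lemma snd_push: "c \<in> atlas M \<Longrightarrow> p \<in> fst c \<Longrightarrow> snd (push c) (\<phi> p) = snd c p"
  by (auto simp: push_chart_def inv_chart)

lemma fst_push: "fst (push c) = \<phi> ` fst c"
  by (simp add: push_chart_def)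

lemma chart_image_push: "c \<in> atlas M \<Longrightarrow> chart_image (push c) = chart_image c"
  unfolding chart_image_def fst_push by (force simp: snd_push)

lemma is_chart_push:
  assumes c: "c \<in> atlas M"
  shows "is_chart (mdim N) (mtop N) (push c)"
proof -
  have o: "openin (mtop N) (\<phi> ` fst c)"
    using homeo atlas_is_chart[OF c] homeomorphic_map_openness_eq unfolding is_chart_def by blast
  have im: "\<psi> ` (topspace (mtop N) \<inter> \<phi> ` fst c) = topspace (mtop M) \<inter> fst c"
    using chart_domain_subset[OF c] openin_subset[OF o] inv_chart[OF c]
    by (force simp: image_iff)
  have "homeomorphic_map (subtopology (mtop N) (\<phi> ` fst c)) (subtopology (mtop M) (fst c)) \<psi>"
    using homeomorphic_map_subtopologies[OF homeo_inv im] .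
  then have "homeomorphic_map (subtopology (mtop N) (\<phi> ` fst c))
      (subtopology (Euclidean_space (mdim M)) (chart_image c)) (snd c \<circ> \<psi>)"
    using atlas_is_chart[OF c] homeomorphic_map_compose unfolding is_chart_def by blast
  then have "homeomorphic_map (subtopology (mtop N) (\<phi> ` fst c))
      (subtopology (Euclidean_space (mdim M)) (chart_image c)) (snd (push c))"
    by (rule homeomorphic_map_eq) (auto simp: push_chart_def)
  then show ?thesis
    using o openin_chart_image[OF c] dim
    unfolding is_chart_def chart_image_push[OF c] fst_push by (auto simp: push_chart_def)
qed

lemma chart_inv_push:
  assumes c: "c \<in> atlas M" and x: "x \<in> chart_image c"
  shows "chart_inv (push c) x = \<phi> (chart_inv c x)"
proof -
  have "snd (push c) (\<phi> (chart_inv c x)) = x"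
    using c x chart_inv_in[OF x]
    by (simp add: snd_push) (simp add: chart_inv_def chart_image_def f_inv_into_f)
  moreover have "\<phi> (chart_inv c x) \<in> fst (push c)"
    using chart_inv_in[OF x] by (simp add: fst_push)
  ultimately show ?thesis
    using is_chart_inj_on[OF is_chart_push[OF c]]
    unfolding chart_inv_def[of "push c"] by (metis inv_into_f_f)
qed

lemma coord_dom_subset: "coord_dom c f c' \<subseteq> chart_image c"
  unfolding coord_dom_def chart_image_def by auto

lemma coord_dom_push_left: "c \<in> atlas M \<Longrightarrow> coord_dom (push c) id c' = coord_dom c \<phi> c'"
  unfolding coord_dom_def fst_push by (force simp: snd_push)

lemma coord_dom_push_right:
  assumes c: "c \<in> atlas M" and c': "c' \<in> atlas N"
  shows "coord_dom c' id (push c) = coord_dom c' \<psi> c"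
proof -
  interpret I: inverse_diffeomorphisms N M \<psi> \<phi>
    by (rule inverse)
  have "id q \<in> fst (push c) \<longleftrightarrow> \<psi> q \<in> fst c" if "q \<in> fst c'" for q
    using that inv_chart[OF c] I.inv_chart[OF c'] by (force simp: fst_push image_iff)
  then show ?thesis
    unfolding coord_dom_def by blast
qed

lemma coord_rep_push_right:
  assumes c: "c \<in> atlas M" and c': "c' \<in> atlas N" and x: "x \<in> coord_dom c' \<psi> c"
  shows "coord_rep c' id (push c) x = coord_rep c' \<psi> c x"
proof -
  interpret I: inverse_diffeomorphisms N M \<psi> \<phi>
    by (rule inverse)
  obtain q where q: "q \<in> fst c'" "\<psi> q \<in> fst c" "x = snd c' q"
    using x unfolding coord_dom_def by blast
  have "chart_inv c' x = q"
    using q is_chart_inj_on[OF I.atlas_is_chart[OF c']] by (simp add: chart_inv_def)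
  moreover have "snd (push c) q = snd c (\<psi> q)"
    using snd_push[OF c q(2)] I.inv_chart[OF c' q(1)] by simp
  ultimately show ?thesis
    by (simp add: coord_rep_def)
qed

text \<open>
  This is where smoothness of both maps and maximality of the atlas of \<open>N\<close> are used: the transition
  maps between a transported chart and a chart of \<open>N\<close> are coordinate representations of \<open>\<phi>\<close> and
  \<open>\<psi>\<close>, so no chain rule is needed.
\<close>

lemma push_in_atlas:
  assumes c: "c \<in> atlas M"
  shows "push c \<in> atlas N"
proof -
  interpret I: inverse_diffeomorphisms N M \<psi> \<phi>
    by (rule inverse)
  have "charts_compatible (mdim N) (push c) c'" if c': "c' \<in> atlas N" for c'
    unfolding charts_compatible_def
  proof
    have "openin (mtop N) (fst c')"
      using I.atlas_is_chart[OF c'] unfolding is_chart_def by blast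
    then have "openin (Euclidean_space (mdim N)) (coord_dom c \<phi> c')"
      using openin_coord_dom[OF atlas_is_chart[OF c]] smooth unfolding smooth_map_def dim by blast
    moreover have "coord_rep c \<phi> c' x = coord_rep (push c) id c' x" if "x \<in> coord_dom c \<phi> c'" for x
      using chart_inv_push[OF c, of x] subsetD[OF coord_dom_subset that] by (simp add: coord_rep_def)
    moreover have "smooth_into_on (mdim N) (mdim N) (coord_dom c \<phi> c') (coord_rep c \<phi> c')"
      using smooth c c' unfolding smooth_map_def dim by blast
    ultimately show "smooth_into_on (mdim N) (mdim N) (coord_dom (push c) id c')
        (coord_rep (push c) id c')"
      using smooth_into_on_cong_open[of "mdim N" "coord_dom c \<phi> c'" "coord_rep c \<phi> c'"
        "coord_rep (push c) id c'"] by (simp add: coord_dom_push_left[OF c])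
    have "openin (mtop M) (fst c)"
      using atlas_is_chart[OF c] unfolding is_chart_def by blast
    then have "openin (Euclidean_space (mdim N)) (coord_dom c' \<psi> c)"
      using openin_coord_dom[OF I.atlas_is_chart[OF c']] smooth_inv unfolding smooth_map_def by blast
    moreover have "smooth_into_on (mdim N) (mdim N) (coord_dom c' \<psi> c) (coord_rep c' \<psi> c)"
      using smooth_inv c c' unfolding smooth_map_def dim by blast
    ultimately show "smooth_into_on (mdim N) (mdim N) (coord_dom c' id (push c))
        (coord_rep c' id (push c))"
      using smooth_into_on_cong_open[of "mdim N" "coord_dom c' \<psi> c" "coord_rep c' \<psi> c"
        "coord_rep c' id (push c)"]
      by (simp add: coord_dom_push_right[OF c c'] coord_rep_push_right[OF c c'])
  qed
  moreover have "is_chart (mdim N) (mtop N) d \<and> (\<forall>c'\<in>atlas N. charts_compatible (mdim N) d c') \<longrightarrow>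
      d \<in> atlas N" for d
    using N unfolding oriented_smooth_manifold_def smooth_structure_def by (elim conjE) (rule spec)
  ultimately show ?thesis
    using is_chart_push[OF c] by simp
qed

lemma push_chart_inverse:
  assumes c: "c \<in> atlas M"
  shows "push_chart \<psi> \<phi> (push c) = c"
proof (rule prod_eqI)
  have im: "\<psi> ` \<phi> ` fst c = fst c"
    using inv_chart[OF c] by force
  then show "fst (push_chart \<psi> \<phi> (push c)) = fst c"
    by (simp add: push_chart_def)
  have "snd c \<in> extensional (fst c)"
    using atlas_is_chart[OF c] unfolding is_chart_def by blast
  moreover have "restrict (restrict (snd c \<circ> \<psi>) (\<phi> ` fst c) \<circ> \<phi>) (fst c) = restrict (snd c) (fst c)"
    by (rule restrict_ext) (simp add: inv_chart[OF c])
  ultimately show "snd (push_chart \<psi> \<phi> (push c)) = snd c"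
    by (simp add: push_chart_def im extensional_restrict)
qed

lemma coord_dom_push:
  assumes c: "c \<in> atlas M" and c': "c' \<in> atlas M"
  shows "coord_dom (push c) id (push c') = coord_dom c id c'"
proof -
  have "\<phi> p \<in> fst (push c') \<longleftrightarrow> id p \<in> fst c'" if "p \<in> fst c" for p
    using inv_chart[OF c that] inv_chart[OF c'] by (force simp: fst_push)
  then show ?thesis
    unfolding coord_dom_push_left[OF c] unfolding coord_dom_def by blast
qed

lemma coord_rep_push:
  assumes c: "c \<in> atlas M" and c': "c' \<in> atlas M" and x: "x \<in> coord_dom c id c'"
  shows "coord_rep (push c) id (push c') x = coord_rep c id c' x"
proof -
  obtain p where p: "p \<in> fst c" "p \<in> fst c'" "x = snd c p"
    using x unfolding coord_dom_def by auto
  have "chart_inv c x = p"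
    using p is_chart_inj_on[OF atlas_is_chart[OF c]] by (simp add: chart_inv_def)
  moreover have "x \<in> chart_image c"
    using p by (simp add: chart_image_def)
  ultimately show ?thesis
    using p c c' by (simp add: coord_rep_def chart_inv_push snd_push)
qed

lemma openin_coord_dom_id:
  assumes c: "c \<in> atlas M" and c': "c' \<in> atlas M"
  shows "openin (Euclidean_space (mdim M)) (coord_dom c id c')"
proof -
  have "openin (mtop M) (fst c')"
    using atlas_is_chart[OF c'] unfolding is_chart_def by blast
  then show ?thesis
    using openin_coord_dom[OF atlas_is_chart[OF c], of "mtop M" id] by simp
qed

lemma differential_coord_rep_push:
  assumes c: "c \<in> atlas M" and c': "c' \<in> atlas M" and x: "x \<in> coord_dom c id c'"
  shows "differential (mdim M) (coord_rep (push c) id (push c')) x =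
    differential (mdim M) (coord_rep c id c') x"
  using differential_cong_open[OF openin_coord_dom_id[OF c c'] x] coord_rep_push[OF c c'] by blast

end

section \<open>Transport of differential forms\<close>

text \<open>
  Pulling back reads off the values of a form on the atlas only. It is therefore injective on
  families that vanish off the atlas, and the cosets that make up cohomology consist of such.
\<close>

definition atlas_supported :: "'a oriented_manifold \<Rightarrow> 'a form set" where
  "atlas_supported M = {\<omega>. \<forall>c. c \<notin> atlas M \<longrightarrow> \<omega> c = (\<lambda>x vs. 0)}"

lemma forms_atlas_supported: "forms M p \<subseteq> atlas_supported M"
  unfolding forms_def atlas_supported_def by (auto simp: fun_eq_iff)

lemma exact_forms_atlas_supported: "exact_forms M p \<subseteq> atlas_supported M"
  unfolding exact_forms_def ext_deriv_def atlas_supported_def by auto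

lemma atlas_supported_add:
  "\<omega> \<in> atlas_supported M \<Longrightarrow> \<eta> \<in> atlas_supported M \<Longrightarrow>
    (\<lambda>c x vs. \<omega> c x vs + \<eta> c x vs) \<in> atlas_supported M"
  unfolding atlas_supported_def by simp

lemma dR_cohomology_atlas_supported:
  assumes "C \<in> dR_cohomology M p"
  shows "C \<subseteq> atlas_supported M"
proof -
  obtain \<omega> where "\<omega> \<in> closed_forms M p" "C = dR_class M p \<omega>"
    using assms unfolding dR_cohomology_def by blast
  then show ?thesis
    using forms_atlas_supported exact_forms_atlas_supported
    unfolding dR_class_def closed_forms_def by (blast intro: atlas_supported_add)
qed

lemma dR_lincomb_atlas_supported:
  assumes "\<And>B. B \<in> set Bs \<Longrightarrow> B \<subseteq> atlas_supported M"
  shows "dR_lincomb M p a Bs \<subseteq> atlas_supported M"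
proof
  fix \<theta>
  assume "\<theta> \<in> dR_lincomb M p a Bs"
  then obtain \<omega> \<eta> where \<theta>: "\<theta> = (\<lambda>c x vs. (\<Sum>i<length Bs. a i * \<omega> i c x vs) + \<eta> c x vs)"
    and \<omega>: "\<And>i. i < length Bs \<Longrightarrow> \<omega> i \<in> Bs ! i" and \<eta>: "\<eta> \<in> exact_forms M p"
    unfolding dR_lincomb_def by blast
  have "\<omega> i \<in> atlas_supported M" if "i < length Bs" for i
    using that \<omega> assms by (meson nth_mem subsetD)
  moreover have "\<eta> \<in> atlas_supported M"
    using \<eta> exact_forms_atlas_supported by blast
  ultimately show "\<theta> \<in> atlas_supported M"
    unfolding \<theta> atlas_supported_def by simp
qed

text \<open>
  The pullback of a form along \<open>\<phi>\<close>: in the charts \<open>c\<close> of \<open>M\<close> and \<open>push_chart \<phi> \<psi> c\<close> of \<open>N\<close> the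
  map \<open>\<phi>\<close> is the identity, so the coordinate representation is taken over unchanged.
\<close>

definition pull_form ::
    "'a oriented_manifold \<Rightarrow> ('a \<Rightarrow> 'b) \<Rightarrow> ('b \<Rightarrow> 'a) \<Rightarrow> 'b form \<Rightarrow> 'a form" where
  "pull_form M \<phi> \<psi> \<omega> = (\<lambda>c x vs. if c \<in> atlas M then \<omega> (push_chart \<phi> \<psi> c) x vs else 0)"

context inverse_diffeomorphisms
begin

abbreviation pull :: "'b form \<Rightarrow> 'a form" where
  "pull \<equiv> pull_form M \<phi> \<psi>"

lemma pull_apply: "c \<in> atlas M \<Longrightarrow> pull \<omega> c = \<omega> (push c)"
  by (simp add: pull_form_def fun_eq_iff)

lemma pull_zero: "pull (\<lambda>c x vs. 0) = (\<lambda>c x vs. 0)"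
  by (simp add: pull_form_def)

lemma pull_add: "pull (\<lambda>c x vs. \<omega> c x vs + \<eta> c x vs) = (\<lambda>c x vs. pull \<omega> c x vs + pull \<eta> c x vs)"
  by (auto simp: pull_form_def fun_eq_iff)

lemma pull_sum:
  "pull (\<lambda>c x vs. \<Sum>i\<in>I. a i * \<omega> i c x vs) = (\<lambda>c x vs. \<Sum>i\<in>I. a i * pull (\<omega> i) c x vs)"
  by (auto simp: pull_form_def fun_eq_iff)

lemma pull_inverse:
  assumes "\<omega> \<in> atlas_supported M"
  shows "pull (pull_form N \<psi> \<phi> \<omega>) = \<omega>"
  using assms push_in_atlas push_chart_inverse
  by (auto simp: pull_form_def atlas_supported_def fun_eq_iff)

lemma inj_on_pull: "inj_on pull (atlas_supported N)"
  by (rule inj_on_inverseI) (rule inverse_diffeomorphisms.pull_inverse[OF inverse])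

text \<open>
  Only the transformation law under a change of charts is not immediate; it survives because the
  transition map between transported charts has the same differential.
\<close>

lemma pull_in_forms:
  assumes \<omega>: "\<omega> \<in> forms N p"
  shows "pull \<omega> \<in> forms M p"
proof -
  let ?V = "\<lambda>vs. set vs \<subseteq> topspace (Euclidean_space (mdim M)) \<and> length vs = p"
  have zero: "\<And>d x vs. \<not> (d \<in> atlas N \<and> x \<in> chart_image d \<and> ?V vs) \<Longrightarrow> \<omega> d x vs = 0"
    and alt: "\<And>d x. d \<in> atlas N \<Longrightarrow> x \<in> chart_image d \<Longrightarrow> alternating_multilinear (mdim M) p (\<omega> d x)"
    and smooth_\<omega>: "\<And>d vs. d \<in> atlas N \<Longrightarrow> ?V vs \<Longrightarrow>
      smooth_fun_on (mdim M) (chart_image d) (\<lambda>x. \<omega> d x vs)"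
    and change: "\<And>d d' x vs. d \<in> atlas N \<Longrightarrow> d' \<in> atlas N \<Longrightarrow> x \<in> coord_dom d id d' \<Longrightarrow> ?V vs \<Longrightarrow>
      \<omega> d x vs = \<omega> d' (coord_rep d id d' x) (map (differential (mdim M) (coord_rep d id d') x) vs)"
    using \<omega> unfolding forms_def dim by blast+
  have 1: "pull \<omega> c x vs = 0" if "\<not> (c \<in> atlas M \<and> x \<in> chart_image c \<and> ?V vs)" for c x vs
    using that zero[of "push c" x vs] by (auto simp: pull_form_def chart_image_push)
  have 2: "alternating_multilinear (mdim M) p (pull \<omega> c x)" if "c \<in> atlas M" "x \<in> chart_image c" for c x
    using that alt[OF push_in_atlas] by (simp add: pull_apply chart_image_push)
  have 3: "smooth_fun_on (mdim M) (chart_image c) (\<lambda>x. pull \<omega> c x vs)" if "c \<in> atlas M" "?V vs" for c vs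
    using smooth_\<omega>[OF push_in_atlas[OF that(1)] that(2)] that(1)
    by (simp add: pull_apply chart_image_push)
  have 4: "pull \<omega> c x vs =
      pull \<omega> c' (coord_rep c id c' x) (map (differential (mdim M) (coord_rep c id c') x) vs)"
    if "c \<in> atlas M" "c' \<in> atlas M" "x \<in> coord_dom c id c'" "?V vs" for c c' x vs
    using change[OF push_in_atlas[OF that(1)] push_in_atlas[OF that(2)] _ that(4), of x] that
    by (simp add: pull_apply coord_dom_push coord_rep_push differential_coord_rep_push)
  show ?thesis
    unfolding forms_def using 1 2 3 4 by blast
qed

lemma pull_image_eqI:
  assumes "S' \<subseteq> atlas_supported M" and "\<And>\<omega>. \<omega> \<in> S \<Longrightarrow> pull \<omega> \<in> S'"
    and "\<And>\<omega>. \<omega> \<in> S' \<Longrightarrow> pull_form N \<psi> \<phi> \<omega> \<in> S"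
  shows "pull ` S = S'"
proof
  show "S' \<subseteq> pull ` S"
  proof
    fix \<omega>
    assume "\<omega> \<in> S'"
    then show "\<omega> \<in> pull ` S"
      using assms(1,3) pull_inverse[of \<omega>] by (metis image_eqI subsetD)
  qed
qed (use assms(2) in blast)

lemma pull_forms: "pull ` forms N p = forms M p"
  using forms_atlas_supported pull_in_forms inverse_diffeomorphisms.pull_in_forms[OF inverse]
  by (rule pull_image_eqI)

lemma ext_deriv_pull: "ext_deriv M (pull \<omega>) = pull (ext_deriv N \<omega>)"
  by (auto simp: ext_deriv_def pull_form_def fun_eq_iff chart_image_push push_in_atlas dim)

lemma wedge_pull: "wedge p q (pull \<alpha>) (pull \<beta>) = pull (wedge p q \<alpha> \<beta>)"
  by (auto simp: wedge_def pull_form_def fun_eq_iff)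

lemma pull_in_closed_forms: "\<omega> \<in> closed_forms N p \<Longrightarrow> pull \<omega> \<in> closed_forms M p"
  by (simp add: closed_forms_def pull_in_forms ext_deriv_pull pull_zero)

lemma pull_closed_forms: "pull ` closed_forms N p = closed_forms M p"
proof (rule pull_image_eqI)
  show "closed_forms M p \<subseteq> atlas_supported M"
    using forms_atlas_supported unfolding closed_forms_def by blast
qed (use pull_in_closed_forms inverse_diffeomorphisms.pull_in_closed_forms[OF inverse] in auto)

lemma pull_exact_forms: "pull ` exact_forms N p = exact_forms M p"
proof (cases "p = 0")
  case False
  then show ?thesis
    unfolding exact_forms_def pull_forms[symmetric] by (simp add: image_image ext_deriv_pull)
qed (simp add: exact_forms_def pull_zero)

section \<open>Transport of de Rham cohomology\<close>

lemma pull_dR_class: "pull ` dR_class N p \<omega> = dR_class M p (pull \<omega>)"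
proof -
  have *: "dR_class L p \<theta> = (\<lambda>\<eta> c x vs. \<theta> c x vs + \<eta> c x vs) ` exact_forms L p"
    for L :: "'c oriented_manifold" and \<theta>
    unfolding dR_class_def by blast
  have "pull ` dR_class N p \<omega> = (\<lambda>\<eta> c x vs. pull \<omega> c x vs + \<eta> c x vs) ` pull ` exact_forms N p"
    by (simp only: * image_image pull_add)
  then show ?thesis
    by (simp only: * pull_exact_forms)
qed

lemma pull_dR_cohomology: "(`) pull ` dR_cohomology N p = dR_cohomology M p"
proof -
  have "dR_cohomology M p = dR_class M p ` pull ` closed_forms N p"
    by (simp only: dR_cohomology_def pull_closed_forms)
  then show ?thesis
    by (simp only: dR_cohomology_def image_image pull_dR_class)
qed

text \<open>
  A linear combination of cosets allows any choice of representatives, so a choice on one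
  side has to be translated into a choice on the other, including the exact summand.
\<close>

lemma pull_dR_lincomb:
  "pull ` dR_lincomb N p a Bs = dR_lincomb M p a (map ((`) pull) Bs)"
proof (intro equalityI subsetI)
  fix \<theta>
  assume "\<theta> \<in> pull ` dR_lincomb N p a Bs"
  then obtain \<omega> \<eta> where
    \<theta>: "\<theta> = pull (\<lambda>c x vs. (\<Sum>i<length Bs. a i * \<omega> i c x vs) + \<eta> c x vs)"
    and \<omega>: "\<forall>i<length Bs. \<omega> i \<in> Bs ! i" and \<eta>: "\<eta> \<in> exact_forms N p"
    unfolding dR_lincomb_def by blast
  have "\<theta> = (\<lambda>c x vs. (\<Sum>i<length Bs. a i * pull (\<omega> i) c x vs) + pull \<eta> c x vs)"
    unfolding \<theta> pull_add pull_sum ..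
  moreover have "pull \<eta> \<in> exact_forms M p"
    using \<eta> pull_exact_forms by blast
  ultimately show "\<theta> \<in> dR_lincomb M p a (map ((`) pull) Bs)"
    using \<omega> unfolding dR_lincomb_def
    by (intro CollectI exI[of _ "\<lambda>i. pull (\<omega> i)"] exI[of _ "pull \<eta>"]) simp
next
  fix \<theta>
  assume "\<theta> \<in> dR_lincomb M p a (map ((`) pull) Bs)"
  then obtain \<omega>' \<eta>' where
    \<theta>: "\<theta> = (\<lambda>c x vs. (\<Sum>i<length Bs. a i * \<omega>' i c x vs) + \<eta>' c x vs)"
    and \<omega>': "\<forall>i<length Bs. \<omega>' i \<in> pull ` (Bs ! i)" and \<eta>': "\<eta>' \<in> exact_forms M p"
    unfolding dR_lincomb_def by auto
  obtain \<eta> where \<eta>: "\<eta> \<in> exact_forms N p" "\<eta>' = pull \<eta>"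
    using \<eta>' pull_exact_forms by blast
  have "\<forall>i. \<exists>\<alpha>. i < length Bs \<longrightarrow> \<alpha> \<in> Bs ! i \<and> \<omega>' i = pull \<alpha>"
    using \<omega>' by blast
  then obtain \<omega> where \<omega>: "\<And>i. i < length Bs \<Longrightarrow> \<omega> i \<in> Bs ! i \<and> \<omega>' i = pull (\<omega> i)"
    by metis
  have "\<theta> = pull (\<lambda>c x vs. (\<Sum>i<length Bs. a i * \<omega> i c x vs) + \<eta> c x vs)"
    unfolding \<theta> \<eta>(2) pull_add pull_sum using \<omega> by simp
  moreover have "(\<lambda>c x vs. (\<Sum>i<length Bs. a i * \<omega> i c x vs) + \<eta> c x vs) \<in> dR_lincomb N p a Bs"
    using \<omega> \<eta>(1) unfolding dR_lincomb_def by blast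
  ultimately show "\<theta> \<in> pull ` dR_lincomb N p a Bs"
    by blast
qed

text \<open>
  Linear independence needs injectivity of the pullback on forms, to conclude that a
  combination is the zero class from its pullback being so.
\<close>

lemma dR_basis_pull:
  assumes "dR_basis N p Bs"
  shows "dR_basis M p (map ((`) pull) Bs)"
  unfolding dR_basis_def
proof (intro conjI ballI allI impI)
  have Bs: "set Bs \<subseteq> dR_cohomology N p"
    and span: "\<And>C. C \<in> dR_cohomology N p \<Longrightarrow> \<exists>a. C = dR_lincomb N p a Bs"
    and indep: "\<And>a i. dR_lincomb N p a Bs = exact_forms N p \<Longrightarrow> i < length Bs \<Longrightarrow> a i = 0"
    using assms unfolding dR_basis_def by blast+
  show "set (map ((`) pull) Bs) \<subseteq> dR_cohomology M p"
    using image_mono[OF Bs, of "(`) pull"] by (simp only: pull_dR_cohomology set_map)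
  show "\<exists>a. C = dR_lincomb M p a (map ((`) pull) Bs)" if C: "C \<in> dR_cohomology M p" for C
  proof -
    obtain D where D: "D \<in> dR_cohomology N p" "C = pull ` D"
      using C unfolding pull_dR_cohomology[symmetric] by blast
    obtain a where "D = dR_lincomb N p a Bs"
      using span[OF D(1)] by (rule exE)
    then show ?thesis
      unfolding D(2) by (simp only: pull_dR_lincomb) (rule exI, rule refl)
  qed
  fix a i
  assume eq: "dR_lincomb M p a (map ((`) pull) Bs) = exact_forms M p"
    and i: "i < length (map ((`) pull) Bs)"
  have "pull ` dR_lincomb N p a Bs = pull ` exact_forms N p"
    using eq by (simp add: pull_dR_lincomb pull_exact_forms)
  moreover have "dR_lincomb N p a Bs \<subseteq> atlas_supported N"
    using Bs dR_cohomology_atlas_supported by (intro dR_lincomb_atlas_supported) blast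
  ultimately have "dR_lincomb N p a Bs = exact_forms N p"
    by (simp only: inj_on_image_eq_iff[OF inj_on_pull _ exact_forms_atlas_supported])
  then show "a i = 0"
    using indep i by simp
qed

section \<open>Transport of partitions of unity\<close>

lemma smooth_partition_of_unity_pull:
  assumes \<rho>: "smooth_partition_of_unity N m c \<rho>"
  shows "smooth_partition_of_unity M m (\<lambda>i. push_chart \<psi> \<phi> (c i)) (\<lambda>i. \<rho> i \<circ> \<phi>)"
proof -
  interpret I: inverse_diffeomorphisms N M \<psi> \<phi>
    by (rule inverse)
  have c: "c i \<in> atlas N" and nonneg: "\<And>q. q \<in> topspace (mtop N) \<Longrightarrow> 0 \<le> \<rho> i q"
    and smooth_\<rho>: "\<And>d. d \<in> atlas N \<Longrightarrow>
      smooth_fun_on (mdim N) (chart_image d) (\<lambda>x. \<rho> i (chart_inv d x))"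
    and support: "mtop N closure_of {q \<in> topspace (mtop N). \<rho> i q \<noteq> 0} \<subseteq> fst (c i)"
    if "i < m" for i
    using \<rho> that unfolding smooth_partition_of_unity_def by blast+
  have sum1: "(\<Sum>i<m. \<rho> i q) = 1" if "q \<in> topspace (mtop N)" for q
    using \<rho> that unfolding smooth_partition_of_unity_def by blast
  have smooth_pull: "smooth_fun_on (mdim M) (chart_image d) (\<lambda>x. (\<rho> i \<circ> \<phi>) (chart_inv d x))"
    if i: "i < m" and d: "d \<in> atlas M" for i d
  proof -
    have "smooth_fun_on (mdim M) (chart_image d) (\<lambda>x. \<rho> i (chart_inv (push d) x))"
      using smooth_\<rho>[OF i push_in_atlas[OF d]] by (simp only: chart_image_push[OF d] dim)
    then show ?thesis
      by (rule smooth_fun_on_cong_open_imp[OF openin_chart_image[OF d], rotated])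
        (simp add: chart_inv_push[OF d])
  qed
  have support_pull: "mtop M closure_of {p \<in> topspace (mtop M). (\<rho> i \<circ> \<phi>) p \<noteq> 0}
      \<subseteq> fst (push_chart \<psi> \<phi> (c i))" if i: "i < m" for i
  proof -
    let ?S = "{q \<in> topspace (mtop N). \<rho> i q \<noteq> 0}"
    have "{p \<in> topspace (mtop M). (\<rho> i \<circ> \<phi>) p \<noteq> 0} = \<psi> ` ?S"
    proof (intro equalityI subsetI)
      fix p
      assume "p \<in> {p \<in> topspace (mtop M). (\<rho> i \<circ> \<phi>) p \<noteq> 0}"
      then have "p = \<psi> (\<phi> p)" "\<phi> p \<in> ?S"
        by (simp_all add: inv phi_in)
      then show "p \<in> \<psi> ` ?S"
        by (rule image_eqI)
    next
      fix p
      assume "p \<in> \<psi> ` ?S"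
      then show "p \<in> {p \<in> topspace (mtop M). (\<rho> i \<circ> \<phi>) p \<noteq> 0}"
        by (auto simp: inv' I.phi_in)
    qed
    moreover have "mtop M closure_of (\<psi> ` ?S) = \<psi> ` (mtop N closure_of ?S)"
      by (rule homeomorphic_map_closure_of[OF homeo_inv]) blast
    ultimately show ?thesis
      using image_mono[OF support[OF i], of \<psi>] by (simp only: I.fst_push)
  qed
  show ?thesis
    unfolding smooth_partition_of_unity_def
  proof (intro conjI allI impI ballI)
    show "push_chart \<psi> \<phi> (c i) \<in> atlas M" if "i < m" for i
      using I.push_in_atlas[OF c[OF that]] .
    show "0 \<le> (\<rho> i \<circ> \<phi>) p" if "i < m" "p \<in> topspace (mtop M)" for i p
      using nonneg[OF that(1) phi_in[OF that(2)]] by simp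
    show "(\<Sum>i<m. (\<rho> i \<circ> \<phi>) p) = 1" if "p \<in> topspace (mtop M)" for p
      using sum1[OF phi_in[OF that]] by simp
  qed (use smooth_pull support_pull in auto)
qed

end

section \<open>Transport of integrals and of the signature\<close>

text \<open>
  Preservation of orientation is stated through transported charts rather than through Jacobians
  of \<open>\<phi>\<close>. In this form it passes to the inverse map without the chain rule.
\<close>

locale oriented_inverse_diffeomorphisms = inverse_diffeomorphisms +
  assumes osign_push:
    "\<And>c p. c \<in> atlas M \<Longrightarrow> p \<in> fst c \<Longrightarrow> osign N (push_chart \<phi> \<psi> c) (\<phi> p) = osign M c p"
begin

lemma oriented_inverse: "oriented_inverse_diffeomorphisms N M \<psi> \<phi>"
proof -
  interpret I: inverse_diffeomorphisms N M \<psi> \<phi>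
    by (rule inverse)
  show ?thesis
  proof
    fix c q
    assume c: "c \<in> atlas N" and q: "q \<in> fst c"
    then have "\<psi> q \<in> fst (I.push c)"
      by (simp add: I.fst_push)
    then have "osign N (push (I.push c)) (\<phi> (\<psi> q)) = osign M (I.push c) (\<psi> q)"
      by (rule osign_push[OF I.push_in_atlas[OF c]])
    then show "osign M (I.push c) (\<psi> q) = osign N c q"
      using I.push_chart_inverse[OF c] I.inv_chart[OF c q] by simp
  qed
qed

text \<open>
  The two integrals have the same integrand on the same chart image, so no change of variables
  is involved.
\<close>

lemma chart_integral_pull:
  assumes c: "c \<in> atlas M" and \<rho>: "\<And>p. p \<in> fst c \<Longrightarrow> \<rho>' p = \<rho> (\<phi> p)"
  shows "chart_integral M c \<rho>' (pull \<omega>) = chart_integral N (push c) \<rho> \<omega>"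
proof -
  have "osign N (push c) (chart_inv (push c) y) * \<rho> (chart_inv (push c) y) =
      osign M c (chart_inv c y) * \<rho>' (chart_inv c y)" if "y \<in> chart_image c" for y
    using osign_push[OF c chart_inv_in[OF that]] \<rho>[OF chart_inv_in[OF that]]
    by (simp add: chart_inv_push[OF c that])
  then show ?thesis
    unfolding chart_integral_def Let_def chart_image_push[OF c] pull_apply[OF c] dim
    by (intro Bochner_Integration.integral_cong) auto
qed

lemma manifold_integral_pull: "manifold_integral M (pull \<omega>) = manifold_integral N \<omega>"
proof -
  interpret I: inverse_diffeomorphisms N M \<psi> \<phi>
    by (rule inverse)
  have "(\<exists>m c \<rho>. smooth_partition_of_unity M m c \<rho> \<and>
          r = (\<Sum>i<m. chart_integral M (c i) (\<rho> i) (pull \<omega>))) \<longleftrightarrow>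
        (\<exists>m c \<rho>. smooth_partition_of_unity N m c \<rho> \<and>
          r = (\<Sum>i<m. chart_integral N (c i) (\<rho> i) \<omega>))" (is "?L \<longleftrightarrow> ?R") for r
  proof
    assume ?L
    then obtain m c \<rho> where \<rho>: "smooth_partition_of_unity M m c \<rho>"
      and r: "r = (\<Sum>i<m. chart_integral M (c i) (\<rho> i) (pull \<omega>))"
      by blast
    have "chart_integral M (c i) (\<rho> i) (pull \<omega>) = chart_integral N (push (c i)) (\<rho> i \<circ> \<psi>) \<omega>"
      if "i < m" for i
    proof (rule chart_integral_pull)
      show "c i \<in> atlas M"
        using \<rho> that unfolding smooth_partition_of_unity_def by blast
      then show "\<rho> i p = (\<rho> i \<circ> \<psi>) (\<phi> p)" if "p \<in> fst (c i)" for p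
        using inv_chart that by simp
    qed
    then have "r = (\<Sum>i<m. chart_integral N (push (c i)) (\<rho> i \<circ> \<psi>) \<omega>)"
      unfolding r by (intro sum.cong) simp_all
    with I.smooth_partition_of_unity_pull[OF \<rho>] show ?R
      by (intro exI conjI)
  next
    assume ?R
    then obtain m c \<rho> where \<rho>: "smooth_partition_of_unity N m c \<rho>"
      and r: "r = (\<Sum>i<m. chart_integral N (c i) (\<rho> i) \<omega>)"
      by blast
    have "chart_integral M (I.push (c i)) (\<rho> i \<circ> \<phi>) (pull \<omega>) = chart_integral N (c i) (\<rho> i) \<omega>"
      if "i < m" for i
    proof -
      have "c i \<in> atlas N"
        using \<rho> that unfolding smooth_partition_of_unity_def by blast
      then show ?thesis
        using chart_integral_pull[of "I.push (c i)" "\<rho> i \<circ> \<phi>" "\<rho> i" \<omega>] I.push_in_atlas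
          I.push_chart_inverse by simp
    qed
    then have "r = (\<Sum>i<m. chart_integral M (I.push (c i)) (\<rho> i \<circ> \<phi>) (pull \<omega>))"
      unfolding r by (intro sum.cong) simp_all
    with smooth_partition_of_unity_pull[OF \<rho>] show ?L
      by (intro exI conjI)
  qed
  then show ?thesis
    unfolding manifold_integral_def by simp
qed

lemma intersection_form_pull:
  "intersection_form M p (pull ` A) (pull ` B) = intersection_form N p A B"
  unfolding intersection_form_def by (simp add: wedge_pull manifold_integral_pull)

lemma intersection_matrix_pull:
  "intersection_matrix M p (map ((`) pull) Bs) = intersection_matrix N p Bs"
  unfolding intersection_matrix_def
  by (intro cong_mat) (simp_all add: intersection_form_pull)

lemma signature_value_pull:
  assumes "\<exists>Bs. dR_basis N p Bs \<and> s = matrix_signature (intersection_matrix N p Bs)"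
  shows "\<exists>Bs. dR_basis M p Bs \<and> s = matrix_signature (intersection_matrix M p Bs)"
proof -
  obtain Bs where "dR_basis N p Bs" "s = matrix_signature (intersection_matrix N p Bs)"
    using assms by blast
  then show ?thesis
    using dR_basis_pull[of p Bs] intersection_matrix_pull[of p Bs]
    by (intro exI[of _ "map ((`) pull) Bs"]) simp
qed

lemma manifold_signature_eq: "manifold_signature M = manifold_signature N"
proof -
  have "(\<exists>Bs. dR_basis M p Bs \<and> s = matrix_signature (intersection_matrix M p Bs)) \<longleftrightarrow>
      (\<exists>Bs. dR_basis N p Bs \<and> s = matrix_signature (intersection_matrix N p Bs))" for p s
    by (rule iffI[OF oriented_inverse_diffeomorphisms.signature_value_pull[OF oriented_inverse]
          signature_value_pull])
  then show ?thesis
    unfolding manifold_signature_def dim by simp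
qed

end

theorem mainTheorem3:
  fixes M :: "'a oriented_manifold" and N :: "'b oriented_manifold"
    and k :: nat and \<phi> :: "'a \<Rightarrow> 'b"
  assumes "compact_oriented_smooth_manifold M" and "mdim M = 4 * k"
    and "compact_oriented_smooth_manifold N" and "mdim N = 4 * k"
    and "diffeomorphism M N \<phi>" and "orientation_preserving M N \<phi>"
  shows "manifold_signature M = manifold_signature N"
proof -
  obtain \<psi> where \<psi>: "smooth_map N M \<psi>"
    "\<And>p. p \<in> topspace (mtop M) \<Longrightarrow> \<psi> (\<phi> p) = p" "\<And>q. q \<in> topspace (mtop N) \<Longrightarrow> \<phi> (\<psi> q) = q"
    using assms(5) unfolding diffeomorphism_def by blast
  interpret inverse_diffeomorphisms M N \<phi> \<psi>
  proof
    show "smooth_map M N \<phi>"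
      using assms(5) unfolding diffeomorphism_def by blast
  qed (use assms \<psi> in \<open>simp_all add: compact_oriented_smooth_manifold_def\<close>)
  have "osign N (push c) (\<phi> p) = osign M c p" if c: "c \<in> atlas M" and p: "p \<in> fst c" for c p
  proof -
    have "\<phi> p \<in> fst (push c)"
      using p by (simp add: fst_push)
    then have "osign M c p = osign N (push c) (\<phi> p) *
        sgn (Determinant.det (jacobian (mdim M) (coord_rep c \<phi> (push c)) (snd c p)))"
      using assms(6) c p push_in_atlas[OF c] unfolding orientation_preserving_def by blast
    \<comment> \<open>In the transported chart the map is the identity, so the sign of its determinant is one.\<close>
    moreover have "jacobian (mdim M) (coord_rep c \<phi> (push c)) (snd c p) = 1\<^sub>m (mdim M)"
    proof (rule jacobian_eq_one[OF openin_chart_image[OF c]])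
      show "snd c p \<in> chart_image c"
        using p by (simp add: chart_image_def)
      fix y
      assume y: "y \<in> chart_image c"
      then show "coord_rep c \<phi> (push c) y = y"
        using snd_push[OF c chart_inv_in[OF y]]
        by (simp add: coord_rep_def) (simp add: chart_inv_def chart_image_def f_inv_into_f)
    qed
    ultimately show ?thesis
      by (simp add: det_one)
  qed
  then interpret oriented_inverse_diffeomorphisms M N \<phi> \<psi>
    by unfold_locales
  show ?thesis
    by (rule manifold_signature_eq)
qed

end
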